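(* Let $\Theta$ be an $r\times s$ matrix with real entries. The homogeneous Kronecker foliation $\mathfrak{f}(\Theta)$ has planar leaves if and only if the columns of $\Theta$ are linearly independent over $\mathbb{Q}$.
   Context: Let $\widetilde{L}(\Theta)\subset\mathbb{R}^{s+r}$ be the graph of $\Theta:\mathbb{R}^{s}\to\mathbb{R}^{r}$ and let $\widetilde{\mathfrak{l}}(\Theta)=\widetilde{L}(\Theta)\cap(\mathbb{R}^{s}\times\boldsymbol{0})$, which is identified with $\mathrm{Ker}(\Theta)\subset\mathbb{R}^{s}$. Let $\mathfrak{l}(\Theta)$ be its image in $\mathbb{T}^{s}=\mathbb{R}^{s}/\mathbb{Z}^{s}$, with the leaf topology (the quotient topology from $\widetilde{\mathfrak{l}}(\Theta)$). The homogeneous Kronecker foliation $\mathfrak{f}(\Theta)=(\mathbb{T}^{s},\mathfrak{l}(\Theta))$ is the foliation of $\mathbb{T}^{s}$ by cosets of $\mathfrak{l}(\Theta)$. Leaves are planar if they are homeomorphic, in the leaf topology, to a Euclidean space (equivalently, to $\widetilde{\mathfrak{l}}(\Theta)$). *)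

theory Defs
  imports "HOL-Analysis.Analysis"
begin

definition lattice_equiv :: "real ^ 's \<Rightarrow> real ^ 's \<Rightarrow> bool"
  where "lattice_equiv x y \<longleftrightarrow> (\<forall>i. x $ i - y $ i \<in> \<int>)"

lemma equivp_lattice_equiv: "equivp lattice_equiv"
proof (rule equivpI)
  show "reflp lattice_equiv"
    by (simp add: reflp_def lattice_equiv_def)
  show "symp lattice_equiv"
    unfolding symp_def lattice_equiv_def by (metis Ints_minus minus_diff_eq)
  show "transp lattice_equiv"
    unfolding transp_def lattice_equiv_def
  proof (intro allI impI)
    fix x y z :: "real ^ 's" and i
    assume "\<forall>i. x $ i - y $ i \<in> \<int>" "\<forall>i. y $ i - z $ i \<in> \<int>"
    then have "(x $ i - y $ i) + (y $ i - z $ i) \<in> \<int>"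
      by (intro Ints_add) auto
    then show "x $ i - z $ i \<in> \<int>" by simp
  qed
qed

quotient_type (overloaded) 's torus = "real ^ ('s::finite)" / lattice_equiv
  morphisms rep_torus torus_proj
  by (rule equivp_lattice_equiv)

instantiation torus :: (finite) ab_group_add
begin

lift_definition zero_torus :: "'a torus" is 0 .

lift_definition plus_torus :: "'a torus \<Rightarrow> 'a torus \<Rightarrow> 'a torus" is "(+)"
  unfolding lattice_equiv_def
  by (simp add: add_diff_add)

lift_definition uminus_torus :: "'a torus \<Rightarrow> 'a torus" is uminus
  unfolding lattice_equiv_def
proof (intro allI)
  fix x y :: "real ^ 'a" and i
  assume "\<forall>i. x $ i - y $ i \<in> \<int>"
  then have "- (x $ i - y $ i) \<in> \<int>"
    by (intro Ints_minus) auto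
  then show "(- x) $ i - (- y) $ i \<in> \<int>"
    by simp
qed

lift_definition minus_torus :: "'a torus \<Rightarrow> 'a torus \<Rightarrow> 'a torus" is "(-)"
  unfolding lattice_equiv_def
proof -
  fix x y z w :: "real ^ 'a"
  assume "\<forall>i. x $ i - y $ i \<in> \<int>" "\<forall>i. z $ i - w $ i \<in> \<int>"
  then have "(x $ i - y $ i) - (z $ i - w $ i) \<in> \<int>" for i
    by (blast intro: Ints_diff)
  then show "\<forall>i. (x - z) $ i - (y - w) $ i \<in> \<int>"
    by (simp add: algebra_simps)
qed

instance
  by (standard; transfer; simp add: lattice_equiv_def)

end

instantiation torus :: (finite) topological_space
begin

definition open_torus :: "'a torus set \<Rightarrow> bool"
  where "open_torus U \<longleftrightarrow> open (torus_proj -` U)"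

instance
proof
  show "open (UNIV :: 'a torus set)"
    by (simp add: open_torus_def)
next
  fix S T :: "'a torus set"
  assume "open S" "open T"
  then show "open (S \<inter> T)"
    by (simp add: open_torus_def open_Int)
next
  fix K :: "'a torus set set"
  assume "\<forall>S\<in>K. open S"
  then show "open (\<Union>K)"
    unfolding open_torus_def vimage_Union by (rule open_UN)
qed

end

lemma torus_proj_eq_iff: "torus_proj x = torus_proj y \<longleftrightarrow> (\<forall>i. x $ i - y $ i \<in> \<int>)"
  by (simp add: torus.abs_eq_iff lattice_equiv_def)

lemma torus_proj_add: "torus_proj (x + y) = torus_proj x + torus_proj y"
  by (simp add: plus_torus.abs_eq)

definition quotient_topology :: "'a topology \<Rightarrow> ('a \<Rightarrow> 'b) \<Rightarrow> 'b topology"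
  where "quotient_topology X f =
    topology (\<lambda>U. U \<subseteq> f ` topspace X \<and> openin X {x \<in> topspace X. f x \<in> U})"

lemma openin_quotient_topology:
  "openin (quotient_topology X f) U \<longleftrightarrow>
    U \<subseteq> f ` topspace X \<and> openin X {x \<in> topspace X. f x \<in> U}"
proof -
  have "istopology (\<lambda>U. U \<subseteq> f ` topspace X \<and> openin X {x \<in> topspace X. f x \<in> U})"
    unfolding istopology_def
  proof (rule conjI; intro allI impI)
    fix S T
    assume "S \<subseteq> f ` topspace X \<and> openin X {x \<in> topspace X. f x \<in> S}"
      and "T \<subseteq> f ` topspace X \<and> openin X {x \<in> topspace X. f x \<in> T}"
    moreover have "{x \<in> topspace X. f x \<in> S \<inter> T} =
        {x \<in> topspace X. f x \<in> S} \<inter> {x \<in> topspace X. f x \<in> T}" by auto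
    ultimately show "S \<inter> T \<subseteq> f ` topspace X \<and> openin X {x \<in> topspace X. f x \<in> S \<inter> T}"
      by auto
  next
    fix K
    assume "\<forall>S\<in>K. S \<subseteq> f ` topspace X \<and> openin X {x \<in> topspace X. f x \<in> S}"
    moreover have "{x \<in> topspace X. f x \<in> \<Union>K} = (\<Union>S\<in>K. {x \<in> topspace X. f x \<in> S})" by auto
    ultimately show "\<Union>K \<subseteq> f ` topspace X \<and> openin X {x \<in> topspace X. f x \<in> \<Union>K}"
      by auto
  qed
  then show ?thesis
    by (simp add: quotient_topology_def)
qed

lemma topspace_quotient_topology: "topspace (quotient_topology X f) = f ` topspace X"
proof -
  have "{x \<in> topspace X. f x \<in> f ` topspace X} = topspace X" by auto
  then have "openin (quotient_topology X f) (f ` topspace X)"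
    by (simp add: openin_quotient_topology)
  moreover have "U \<subseteq> f ` topspace X" if "openin (quotient_topology X f) U" for U
    using that by (simp add: openin_quotient_topology)
  ultimately show ?thesis
    by (intro subset_antisym openin_subset) auto
qed

lemma quotient_map_quotient_topology: "quotient_map X (quotient_topology X f) f"
  by (auto simp: quotient_map_def topspace_quotient_topology openin_quotient_topology)

definition matrix_graph :: "real ^ 's ^ 'r \<Rightarrow> ((real ^ 's) \<times> (real ^ 'r)) set"
  where "matrix_graph \<Theta> = {(x, \<Theta> *v x) | x. True}"

text \<open>The intersection of the graph with \<open>\<real>\<^sup>s \<times> 0\<close>, regarded as a subset of \<open>\<real>\<^sup>s\<close>.\<close>

definition kernel_lift :: "real ^ 's ^ 'r \<Rightarrow> (real ^ 's) set"
  where "kernel_lift \<Theta> = fst ` (matrix_graph \<Theta> \<inter> (UNIV \<times> {0}))"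

lemma kernel_lift_eq: "kernel_lift \<Theta> = {x. \<Theta> *v x = 0}"
  for \<Theta> :: "real ^ 'a ^ 'b"
proof
  show "kernel_lift \<Theta> \<subseteq> {x. \<Theta> *v x = 0}"
    by (auto simp: kernel_lift_def matrix_graph_def)
  show "{x. \<Theta> *v x = 0} \<subseteq> kernel_lift \<Theta>"
  proof
    fix x assume "x \<in> {x. \<Theta> *v x = 0}"
    then have "(x, 0) \<in> matrix_graph \<Theta> \<inter> (UNIV \<times> {0})"
      by (simp add: matrix_graph_def)
    then have "fst (x, 0 :: real ^ 'b) \<in> kernel_lift \<Theta>"
      unfolding kernel_lift_def by (rule imageI)
    then show "x \<in> kernel_lift \<Theta>" by simp
  qed
qed

definition kernel_leaf :: "real ^ 's ^ 'r \<Rightarrow> 's torus set"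
  where "kernel_leaf \<Theta> = torus_proj ` kernel_lift \<Theta>"

text \<open>The leaf through \<open>t\<close>, i.e. the coset \<open>t + kernel_leaf \<Theta>\<close>, with the leaf topology
  transported from \<open>kernel_leaf \<Theta>\<close> by translation. It is in general strictly finer than the
  subspace topology from the torus. The lemmas below show that it has the coset as
  underlying set and does not depend on the choice of \<open>t\<close> in the coset.\<close>

definition leaf_topology :: "real ^ 's ^ 'r \<Rightarrow> 's torus \<Rightarrow> 's torus topology"
  where "leaf_topology \<Theta> t =
    quotient_topology (top_of_set (kernel_lift \<Theta>)) (\<lambda>x. t + torus_proj x)"

lemma leaf_topology_zero:
  "leaf_topology \<Theta> 0 = quotient_topology (top_of_set (kernel_lift \<Theta>)) torus_proj"
  by (simp add: leaf_topology_def)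

lemma topspace_leaf_topology: "topspace (leaf_topology \<Theta> t) = (+) t ` kernel_leaf \<Theta>"
  by (simp add: leaf_topology_def topspace_quotient_topology kernel_leaf_def image_image)

lemma homeomorphic_map_translation:
  "homeomorphic_map (leaf_topology \<Theta> 0) (leaf_topology \<Theta> t) ((+) t)"
proof -
  let ?X = "top_of_set (kernel_lift \<Theta>)"
  have "quotient_map ?X (leaf_topology \<Theta> t) ((+) t \<circ> torus_proj)"
    using quotient_map_quotient_topology[of ?X "\<lambda>x. t + torus_proj x"]
    by (simp add: leaf_topology_def comp_def)
  moreover have "quotient_map ?X (leaf_topology \<Theta> 0) torus_proj"
    unfolding leaf_topology_zero by (rule quotient_map_quotient_topology)
  ultimately have "quotient_map (leaf_topology \<Theta> 0) (leaf_topology \<Theta> t) ((+) t)"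
    using quotient_map_compose_eq by blast
  then show ?thesis
    by (simp add: homeomorphic_map_def)
qed

lemma leaf_topology_cong:
  assumes "t' \<in> topspace (leaf_topology \<Theta> t)"
  shows "leaf_topology \<Theta> t' = leaf_topology \<Theta> t"
proof -
  obtain v where v: "\<Theta> *v v = 0" and t': "t' = t + torus_proj v"
    using assms by (auto simp: topspace_leaf_topology kernel_leaf_def kernel_lift_eq)
  let ?K = "kernel_lift \<Theta>"
  have eq: "t' + torus_proj x = t + torus_proj (v + x)" for x
    by (simp add: t' torus_proj_add add.assoc)
  have "homeomorphic_maps (top_of_set ?K) (top_of_set ?K) ((+) v) (\<lambda>x. x - v)"
    unfolding homeomorphic_maps_def using v
    by (auto simp: kernel_lift_eq matrix_vector_right_distrib matrix_vector_mult_diff_distrib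
        intro!: continuous_intros)
  then have hom: "homeomorphic_map (top_of_set ?K) (top_of_set ?K) ((+) v)"
    using homeomorphic_map_maps by blast
  have q: "quotient_map (top_of_set ?K) (leaf_topology \<Theta> t) (\<lambda>x. t' + torus_proj x)"
  proof -
    have "quotient_map (top_of_set ?K) (leaf_topology \<Theta> t) ((\<lambda>x. t + torus_proj x) \<circ> (+) v)"
      unfolding leaf_topology_def
      by (rule quotient_map_compose[OF _ quotient_map_quotient_topology])
        (use hom in \<open>simp add: homeomorphic_map_def\<close>)
    then show ?thesis by (simp add: comp_def eq)
  qed
  moreover have "quotient_map (top_of_set ?K) (leaf_topology \<Theta> t') (\<lambda>x. t' + torus_proj x)"
    unfolding leaf_topology_def by (rule quotient_map_quotient_topology)
  ultimately have "quotient_map (leaf_topology \<Theta> t') (leaf_topology \<Theta> t) id"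
    using quotient_map_compose_eq[where g = id] by (metis id_comp)
  then have "homeomorphic_map (leaf_topology \<Theta> t') (leaf_topology \<Theta> t) id"
    by (simp only: homeomorphic_map_def inj_on_id simp_thms)
  then show ?thesis
    by simp
qed

text \<open>A foliation is given by its leaves, each leaf by its leaf topology, whose underlying set
  is the leaf.\<close>

definition homogeneous_kronecker_foliation :: "real ^ 's ^ 'r \<Rightarrow> 's torus topology set"
  where "homogeneous_kronecker_foliation \<Theta> = range (leaf_topology \<Theta>)"

definition has_planar_leaves :: "'a topology set \<Rightarrow> bool"
  where "has_planar_leaves \<F> \<longleftrightarrow> (\<forall>L\<in>\<F>. \<exists>n. L homeomorphic_space Euclidean_space n)"

text \<open>Linear independence of the columns as a family indexed by \<open>'s\<close>: repeated columns
  are dependent, unlike for the set \<^term>\<open>columns \<Theta>\<close>.\<close>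

definition columns_rat_independent :: "real ^ 's ^ 'r \<Rightarrow> bool"
  where "columns_rat_independent \<Theta> \<longleftrightarrow>
    (\<forall>q :: 's \<Rightarrow> rat. (\<Sum>j\<in>UNIV. of_rat (q j) *\<^sub>R column j \<Theta>) = 0 \<longrightarrow> (\<forall>j. q j = 0))"

lemma columns_rat_independent_iff:
  "columns_rat_independent \<Theta> \<longleftrightarrow>
    inj (\<lambda>j. column j \<Theta>) \<and>
    \<not> module.dependent (\<lambda>q. (*\<^sub>R) (of_rat q)) (columns \<Theta>)"
proof -
  interpret Q: vector_space "\<lambda>q. (*\<^sub>R) (of_rat q) :: real ^ 'b \<Rightarrow> real ^ 'b"
    by standard (auto simp: of_rat_add of_rat_mult scaleR_add_left scaleR_add_right)
  let ?c = "\<lambda>j. column j \<Theta>"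
  have C: "columns \<Theta> = range ?c"
    by (auto simp: columns_def)
  have sum_C: "(\<Sum>v\<in>range ?c. of_rat (u v) *\<^sub>R v) = (\<Sum>j\<in>UNIV. of_rat (u (?c j)) *\<^sub>R ?c j)"
    if "inj ?c" for u :: "real ^ 'b \<Rightarrow> rat"
    using sum.reindex[OF that, of "\<lambda>v. of_rat (u v) *\<^sub>R v"] by simp
  show ?thesis
  proof (intro iffI conjI)
    assume ind: "columns_rat_independent \<Theta>"
    show inj: "inj ?c"
    proof (rule injI, rule ccontr)
      fix i j assume ij: "?c i = ?c j" "i \<noteq> j"
      let ?q = "\<lambda>k. if k = i then 1 else if k = j then -1 else 0 :: rat"
      have "(\<Sum>k\<in>UNIV. of_rat (?q k) *\<^sub>R ?c k) = (\<Sum>k\<in>{i, j}. of_rat (?q k) *\<^sub>R ?c k)"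
        by (rule sum.mono_neutral_right) auto
      also have "\<dots> = 0"
        using ij by simp
      finally have "?q i = 0"
        using ind[unfolded columns_rat_independent_def, rule_format, of ?q i] by simp
      then show False by simp
    qed
    show "\<not> Q.dependent (columns \<Theta>)"
    proof
      assume "Q.dependent (columns \<Theta>)"
      then obtain u v where u: "(\<Sum>v\<in>range ?c. of_rat (u v) *\<^sub>R v) = 0"
        and v: "v \<in> range ?c" "u v \<noteq> 0"
        unfolding C by (subst (asm) Q.dependent_finite) auto
      have "\<forall>j. u (?c j) = 0"
        using ind[unfolded columns_rat_independent_def, rule_format, of "\<lambda>j. u (?c j)"]
          u[unfolded sum_C[OF inj]] by blast
      with v show False by auto
    qed
  next
    assume "inj ?c \<and> \<not> Q.dependent (columns \<Theta>)"
    then have inj: "inj ?c" and ind: "\<not> Q.dependent (range ?c)"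
      by (simp_all add: C)
    show "columns_rat_independent \<Theta>"
      unfolding columns_rat_independent_def
    proof (intro allI impI)
      fix q :: "'a \<Rightarrow> rat" and j
      assume q: "(\<Sum>j\<in>UNIV. of_rat (q j) *\<^sub>R ?c j) = 0"
      define u where "u = q \<circ> inv ?c"
      have "(\<Sum>v\<in>range ?c. of_rat (u v) *\<^sub>R v) = 0"
        using q by (simp only: sum_C[OF inj] u_def comp_def inv_f_f[OF inj])
      moreover have "finite (range ?c)" by simp
      ultimately have "u (?c j) = 0"
        using ind Q.dependent_finite by blast
      then show "q j = 0"
        by (simp add: u_def inv_f_f[OF inj])
    qed
  qed
qed

end

theory Submission
  imports Defs "HOL-Homology.Invariance_of_Domain"
begin

text \<open>
  The leaf through \<open>0\<close> is the quotient of \<open>K = Ker \<Theta>\<close> by the group \<open>K \<inter> \<int>\<^sup>s\<close> of its integer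
  points, and all leaves are translates of it. A rational relation between the columns of \<open>\<Theta>\<close>
  becomes, once denominators are cleared, a nonzero integer point of \<open>K\<close>, and conversely. So the
  claim is that \<open>K / (K \<inter> \<int>\<^sup>s)\<close> is homeomorphic to a Euclidean space exactly if
  \<open>K \<inter> \<int>\<^sup>s = 0\<close>.

  If \<open>K \<inter> \<int>\<^sup>s = 0\<close>, the projection of \<open>K\<close> onto the leaf is an injective quotient map, hence a
  homeomorphism, and \<open>K\<close> is a linear subspace.

  If \<open>v\<close> is a nonzero point of \<open>K \<inter> \<int>\<^sup>s\<close>, say \<open>v\<^sub>j \<noteq> 0\<close>, then the segment from \<open>0\<close> to \<open>v\<close> becomes
  a loop in the leaf. The \<open>j\<close>-th coordinate defines a continuous function
  \<open>x \<mapsto> exp (2\<pi>\<i> x\<^sub>j)\<close> from the leaf to the circle, which maps this loop to a loop of winding number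
  \<open>v\<^sub>j\<close>. In a contractible space, and in particular in a Euclidean space, every circle-valued
  function has winding number zero along every loop (\<open>contractible_space_imp_winding_zero\<close>), so the
  leaf is not planar.
\<close>

text \<open>Two logarithms of the same number differ by a multiple of \<open>2\<pi>\<i>\<close>, so a continuous function
  that takes values among them cannot jump.\<close>

lemma constant_on_if_exp_constant:
  fixes u :: "'a::topological_space \<Rightarrow> complex"
  assumes "connected S" "continuous_on S u" and exp_u: "\<And>x. x \<in> S \<Longrightarrow> exp (u x) = c"
  shows "u constant_on S"
proof (rule continuous_discrete_range_constant[OF assms(1,2)])
  fix x assume x: "x \<in> S"
  have "2 * pi \<le> norm (u y - u x)" if y: "y \<in> S" "u y \<noteq> u x" for y
  proof (rule ccontr)
    assume "\<not> 2 * pi \<le> norm (u y - u x)"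
    then have "\<bar>Im (u y) - Im (u x)\<bar> < 2 * pi"
      using abs_Im_le_cmod[of "u y - u x"] by simp
    moreover have "exp (u y) = exp (u x)"
      using exp_u x y by simp
    ultimately have "u y = u x"
      by (rule exp_complex_eqI)
    with y show False by simp
  qed
  then show "\<exists>e>0. \<forall>y. y \<in> S \<and> u y \<noteq> u x \<longrightarrow> e \<le> norm (u y - u x)"
    by (intro exI[of _ "2 * pi"]) auto
qed

text \<open>The increment \<open>g 1 - g 0\<close> of the logarithm is \<open>2\<pi>\<i>\<close> times the winding number of \<open>f \<circ> p\<close>
  around \<open>0\<close>. A contraction of the space deforms \<open>f \<circ> p\<close> through loops to a constant loop. The
  deformation is a map on the unit square, where it has a continuous logarithm, and the increment
  of this logarithm does not change during the deformation.\<close>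

lemma contractible_space_imp_winding_zero:
  fixes f :: "'a \<Rightarrow> complex" and p :: "real \<Rightarrow> 'a" and g :: "real \<Rightarrow> complex"
  assumes X: "contractible_space X"
    and f: "continuous_map X (top_of_set (- {0})) f"
    and p: "continuous_map (top_of_set {0..1}) X p" "p 0 = p 1"
    and g: "continuous_on {0..1} g" "\<And>t. t \<in> {0..1} \<Longrightarrow> f (p t) = exp (g t)"
  shows "g 0 = g 1"
proof -
  let ?I = "{0..1} :: real set"
  obtain c where "homotopic_with (\<lambda>_. True) X (top_of_set (- {0})) f (\<lambda>_. c)"
    using nullhomotopic_from_contractible_space[OF f X] by blast
  then obtain h where h: "continuous_map (prod_topology (top_of_set ?I) X) (top_of_set (- {0})) h"
    and h0: "\<And>x. h (0, x) = f x" and h1: "\<And>x. h (1, x) = c"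
    unfolding homotopic_with_def by auto
  define H where "H = h \<circ> (\<lambda>z. (fst z, p (snd z)))"
  have "continuous_map (prod_topology (top_of_set ?I) (top_of_set ?I))
      (prod_topology (top_of_set ?I) X) (\<lambda>z. (fst z, p (snd z)))"
    using continuous_map_compose[OF continuous_map_snd p(1), of "top_of_set ?I"]
    by (intro continuous_map_pairedI continuous_map_fst) (simp only: comp_def)
  then have "continuous_map (prod_topology (top_of_set ?I) (top_of_set ?I)) (top_of_set (- {0})) H"
    unfolding H_def using h by (rule continuous_map_compose)
  then have "continuous_map (top_of_set (?I \<times> ?I)) (top_of_set (- {0})) H"
    by (simp add: prod_topology_subtopology_eu)
  then have H: "continuous_on (?I \<times> ?I) H" "\<And>z. z \<in> ?I \<times> ?I \<Longrightarrow> H z \<noteq> 0"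
    by (auto simp: continuous_map_in_subtopology)
  have "contractible (?I \<times> ?I)"
    by (intro convex_imp_contractible convex_Times) auto
  from continuous_logarithm_on_contractible[OF H(1) this H(2)]
  obtain G where G: "continuous_on (?I \<times> ?I) G" "\<And>z. z \<in> ?I \<times> ?I \<Longrightarrow> H z = exp (G z)"
    by blast
  have I: "connected ?I" by simp
  have G_right: "continuous_on ?I (\<lambda>t. G (s, t))" if "s \<in> ?I" for s
    by (rule continuous_on_compose2[OF G(1)]) (use that in \<open>auto intro!: continuous_intros\<close>)
  have G_left: "continuous_on ?I (\<lambda>s. G (s, t))" if "t \<in> ?I" for t
    by (rule continuous_on_compose2[OF G(1)]) (use that in \<open>auto intro!: continuous_intros\<close>)
  have H_ends: "H (s, 0) = H (s, 1)" for s
    using p(2) by (simp add: H_def)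
  have "(\<lambda>s. G (s, 1) - G (s, 0)) constant_on ?I"
  proof (rule constant_on_if_exp_constant[OF I])
    show "continuous_on ?I (\<lambda>s. G (s, 1) - G (s, 0))"
      by (intro continuous_on_diff G_left) auto
    show "exp (G (s, 1) - G (s, 0)) = 1" if "s \<in> ?I" for s
      using that G(2)[of "(s, 0)"] G(2)[of "(s, 1)"] H_ends[of s] by (simp add: exp_diff)
  qed
  then have "G (0, 1) - G (0, 0) = G (1, 1) - G (1, 0)"
    unfolding constant_on_def by force
  moreover have "(\<lambda>t. G (1, t)) constant_on ?I"
  proof (rule constant_on_if_exp_constant[OF I G_right])
    show "exp (G (1, t)) = c" if "t \<in> ?I" for t
      using that G(2)[of "(1, t)"] by (simp add: H_def h1)
  qed simp
  then have "G (1, 1) = G (1, 0)"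
    unfolding constant_on_def by force
  moreover have "(\<lambda>t. G (0, t) - g t) constant_on ?I"
  proof (rule constant_on_if_exp_constant[OF I])
    show "continuous_on ?I (\<lambda>t. G (0, t) - g t)"
      by (intro continuous_on_diff G_right g) auto
    show "exp (G (0, t) - g t) = 1" if "t \<in> ?I" for t
      using that G(2)[of "(0, t)"] g(2)[of t] by (simp add: H_def h0 exp_diff)
  qed
  then have "G (0, 1) - g 1 = G (0, 0) - g 0"
    unfolding constant_on_def by force
  ultimately show ?thesis by simp
qed

lemma rat_clear_denominators:
  fixes q :: "'a \<Rightarrow> rat"
  assumes "finite A"
  obtains N :: int where "N > 0" "\<And>j. j \<in> A \<Longrightarrow> of_int N * q j \<in> \<int>"
proof
  let ?d = "\<lambda>j. snd (quotient_of (q j))"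
  show "(\<Prod>j\<in>A. ?d j) > 0"
    by (intro prod_pos) (simp add: quotient_of_denom_pos')
  show "of_int (\<Prod>j\<in>A. ?d j) * q j \<in> \<int>" if "j \<in> A" for j
  proof -
    have "of_int (?d j) * q j = of_int (fst (quotient_of (q j)))"
      using quotient_of_div[of "q j"] quotient_of_denom_pos'[of "q j"]
      by (cases "quotient_of (q j)") auto
    moreover have "(\<Prod>j\<in>A. ?d j) = (\<Prod>j\<in>A - {j}. ?d j) * ?d j"
      using prod.remove[OF assms that, of ?d] by simp
    ultimately have "of_int (\<Prod>j\<in>A. ?d j) * q j =
        of_int ((\<Prod>j\<in>A - {j}. ?d j) * fst (quotient_of (q j)))"
      by (simp only: of_int_mult mult.assoc)
    then show ?thesis by (simp only: Ints_of_int)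
  qed
qed

lemma columns_rat_independent_iff_integer_kernel:
  fixes \<Theta> :: "real ^ 's ^ 'r"
  shows "columns_rat_independent \<Theta> \<longleftrightarrow>
    (\<forall>v. \<Theta> *v v = 0 \<longrightarrow> (\<forall>j. v $ j \<in> \<int>) \<longrightarrow> v = 0)"
proof
  assume ind: "columns_rat_independent \<Theta>"
  show "\<forall>v. \<Theta> *v v = 0 \<longrightarrow> (\<forall>j. v $ j \<in> \<int>) \<longrightarrow> v = 0"
  proof (intro allI impI)
    fix v assume v: "\<Theta> *v v = 0" "\<forall>j. v $ j \<in> \<int>"
    have v_floor: "of_rat (of_int \<lfloor>v $ j\<rfloor>) = v $ j" for j
      using v(2) by (simp add: of_int_floor_cancel)
    have "(\<Sum>j\<in>UNIV. of_rat (of_int \<lfloor>v $ j\<rfloor>) *\<^sub>R column j \<Theta>) = 0"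
      unfolding v_floor using v(1) by (simp add: matrix_mult_sum scalar_mult_eq_scaleR)
    then have "\<forall>j. (of_int \<lfloor>v $ j\<rfloor> :: rat) = 0"
      using ind unfolding columns_rat_independent_def
      by (elim allE[where x = "\<lambda>j. of_int \<lfloor>v $ j\<rfloor>"]) simp
    then show "v = 0"
      using v_floor by (metis of_rat_0 vec_eq_iff zero_index)
  qed
next
  assume ker: "\<forall>v. \<Theta> *v v = 0 \<longrightarrow> (\<forall>j. v $ j \<in> \<int>) \<longrightarrow> v = 0"
  show "columns_rat_independent \<Theta>"
    unfolding columns_rat_independent_def
  proof (intro allI impI)
    fix q :: "'s \<Rightarrow> rat" and j
    assume q: "(\<Sum>j\<in>UNIV. of_rat (q j) *\<^sub>R column j \<Theta>) = 0"
    obtain N :: int where N: "N > 0" "\<And>j. of_int N * q j \<in> \<int>"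
      using rat_clear_denominators[of UNIV q] by auto
    define v :: "real ^ 's" where "v = (\<chi> j. of_rat (of_int N * q j))"
    have "\<Theta> *v v = of_int N *\<^sub>R (\<Sum>j\<in>UNIV. of_rat (q j) *\<^sub>R column j \<Theta>)"
      by (simp add: v_def matrix_mult_sum scalar_mult_eq_scaleR scaleR_sum_right of_rat_mult)
    then have "\<Theta> *v v = 0"
      by (simp add: q)
    moreover have "\<forall>j. v $ j \<in> \<int>"
    proof
      fix j
      obtain n where "of_int N * q j = of_int n"
        using N(2)[of j] by (auto elim: Ints_cases)
      then show "v $ j \<in> \<int>"
        by (simp only: v_def vec_lambda_beta of_rat_of_int_eq Ints_of_int)
    qed
    ultimately have "v = 0"
      using ker by blast
    then have "v $ j = 0"
      by simp
    then show "q j = 0"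
      using N(1) by (simp add: v_def)
  qed
qed

lemma subspace_kernel_lift: "subspace (kernel_lift \<Theta>)"
  unfolding kernel_lift_eq
  by (simp add: subspace_def matrix_vector_right_distrib matrix_vector_mult_scaleR)

lemma leaf_planar_if_integer_kernel_trivial:
  fixes \<Theta> :: "real ^ 's ^ 'r"
  assumes ker: "\<And>v. \<Theta> *v v = 0 \<Longrightarrow> (\<forall>j. v $ j \<in> \<int>) \<Longrightarrow> v = 0"
  shows "leaf_topology \<Theta> t homeomorphic_space Euclidean_space (dim (kernel_lift \<Theta>))"
proof -
  let ?K = "kernel_lift \<Theta>"
  have "inj_on (\<lambda>x. t + torus_proj x) ?K"
  proof (rule inj_onI)
    fix x y assume xy: "x \<in> ?K" "y \<in> ?K" "t + torus_proj x = t + torus_proj y"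
    then have "x - y = 0"
      by (intro ker) (auto simp: kernel_lift_eq matrix_vector_mult_diff_distrib torus_proj_eq_iff)
    then show "x = y" by simp
  qed
  then have "homeomorphic_map (top_of_set ?K) (leaf_topology \<Theta> t) (\<lambda>x. t + torus_proj x)"
    unfolding homeomorphic_map_def leaf_topology_def
    by (simp add: quotient_map_quotient_topology)
  then have "leaf_topology \<Theta> t homeomorphic_space top_of_set ?K"
    using homeomorphic_map_imp_homeomorphic_space homeomorphic_space_sym by blast
  then show ?thesis
    using homeomorphic_subspace_Euclidean_space_dim[OF subspace_kernel_lift]
      homeomorphic_space_trans by blast
qed

text \<open>The segment \<open>t \<mapsto> t v\<close> projects to a closed loop in the leaf, and the circle-valued function
  defined by the \<open>j\<close>-th coordinate has winding number \<open>v\<^sub>j\<close> along it. Hence \<open>v\<^sub>j = 0\<close> for all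
  \<open>j\<close>.\<close>

lemma integer_kernel_trivial_if_leaf_contractible:
  fixes \<Theta> :: "real ^ 's ^ 'r"
  assumes contr: "contractible_space (leaf_topology \<Theta> 0)"
    and v: "\<Theta> *v v = 0" "\<forall>j. v $ j \<in> \<int>"
  shows "v = 0"
proof -
  let ?K = "kernel_lift \<Theta>"
  let ?e = "\<lambda>x :: real. exp (2 * of_real pi * \<i> * of_real x)"
  have q: "quotient_map (top_of_set ?K) (leaf_topology \<Theta> 0) torus_proj"
    unfolding leaf_topology_zero by (rule quotient_map_quotient_topology)
  have "v $ j = 0" for j
  proof -
    \<comment> \<open>Representatives of a point of the torus differ by integers, so the choice made here does not
      affect the value of the exponential.\<close>
    define f where "f = (\<lambda>y :: 's torus. ?e (rep_torus y $ j))"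
    have f_proj: "f (torus_proj x) = ?e (x $ j)" for x
    proof -
      have "torus_proj (rep_torus (torus_proj x)) = torus_proj x"
        by (rule Quotient_abs_rep[OF Quotient_torus])
      then obtain n where n: "rep_torus (torus_proj x) $ j - x $ j = of_int n"
        unfolding torus_proj_eq_iff by (auto elim: Ints_cases)
      then have "rep_torus (torus_proj x) $ j = x $ j + of_int n"
        by simp
      then have "f (torus_proj x) = ?e (x $ j) * exp (2 * of_real pi * \<i> * of_int n)"
        by (simp only: f_def of_real_add of_real_of_int_eq distrib_left exp_add)
      also have "exp (2 * of_real pi * \<i> * of_int n) = 1"
        using exp_integer_2pi[of "of_int n"] by (simp add: mult_ac)
      finally show ?thesis by simp
    qed
    have "continuous_map (top_of_set ?K) (top_of_set (- {0})) (f \<circ> torus_proj)"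
      by (auto simp: comp_def f_proj continuous_map_in_subtopology intro!: continuous_intros)
    then have f: "continuous_map (leaf_topology \<Theta> 0) (top_of_set (- {0})) f"
      using continuous_compose_quotient_map[OF q] by blast
    have "continuous_map (top_of_set {0..1}) (top_of_set ?K) (\<lambda>t. t *\<^sub>R v)"
      using v(1) by (auto simp: continuous_map_in_subtopology kernel_lift_eq
          matrix_vector_mult_scaleR intro!: continuous_intros)
    then have p: "continuous_map (top_of_set {0..1}) (leaf_topology \<Theta> 0) (\<lambda>t. torus_proj (t *\<^sub>R v))"
      by (rule continuous_map_compose[OF _ quotient_imp_continuous_map[OF q], unfolded comp_def])
    have closed_loop: "torus_proj (0 *\<^sub>R v) = torus_proj (1 *\<^sub>R v)"
      using v(2) by (simp add: torus_proj_eq_iff)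
    have "2 * of_real pi * \<i> * of_real ((0 *\<^sub>R v) $ j) =
        2 * of_real pi * \<i> * of_real ((1 *\<^sub>R v) $ j)"
      by (rule contractible_space_imp_winding_zero[OF contr f p closed_loop])
        (auto simp: f_proj intro!: continuous_intros)
    then show ?thesis by simp
  qed
  then show ?thesis by (simp add: vec_eq_iff)
qed

theorem theorem12:
  fixes \<Theta> :: "real ^ 's ^ 'r"
  shows "has_planar_leaves (homogeneous_kronecker_foliation \<Theta>) \<longleftrightarrow>
    columns_rat_independent \<Theta>"
proof
  assume "has_planar_leaves (homogeneous_kronecker_foliation \<Theta>)"
  then obtain n where "leaf_topology \<Theta> 0 homeomorphic_space Euclidean_space n"
    unfolding has_planar_leaves_def homogeneous_kronecker_foliation_def by blast
  then have "contractible_space (leaf_topology \<Theta> 0)"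
    using homeomorphic_space_contractibility contractible_Euclidean_space by blast
  then show "columns_rat_independent \<Theta>"
    unfolding columns_rat_independent_iff_integer_kernel
    using integer_kernel_trivial_if_leaf_contractible by blast
next
  assume "columns_rat_independent \<Theta>"
  then show "has_planar_leaves (homogeneous_kronecker_foliation \<Theta>)"
    unfolding columns_rat_independent_iff_integer_kernel has_planar_leaves_def
      homogeneous_kronecker_foliation_def
    using leaf_planar_if_integer_kernel_trivial by blast
qed

end
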